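(* Let $f\in\mathbb{C}[x_1,x_2,x_3]$ be a nonconstant polynomial. The following conditions are equivalent: (i) $U(f)\equiv 0$, i.e. $U(f)$ is the zero polynomial; (ii) there exists $0\neq w\in\mathbb{C}^{3}$ such that $D_{w}f:=w\cdot\nabla f\equiv 0$; (iii) after a change of coordinates in $\mathrm{GL}_{3}(\mathbb{C})$, $f\in\mathbb{C}[x_1,x_2]$; that is, there exists $A\in\mathrm{GL}_3(\mathbb{C})$ such that the polynomial $f(Ax)$ lies in $\mathbb{C}[x_1,x_2]$.
   Context: For $f\in\mathbb{C}[x_1,x_2,x_3]$, $\nabla f$ denotes the gradient (the column vector of first partial derivatives), $\operatorname{Hess} f$ the $3\times 3$ Hessian matrix of second partial derivatives, and $\operatorname{adj}$ the adjugate matrix. Define the polynomial $$U(f)=(\nabla f)^{T}\,\operatorname{adj}(\operatorname{Hess} f)\,\nabla f .$$ (Equivalently, $U(f)=-\det B(f)$, where $B(f)=\begin{pmatrix}\operatorname{Hess} f & \nabla f\\ (\nabla f)^{T} & 0\end{pmatrix}$ is the bordered Hessian.) For $w=(w_1,w_2,w_3)\in\mathbb{C}^3$, $w\cdot\nabla f=\sum_{i} w_i\,\partial f/\partial x_i$ (the bilinear, not Hermitian, pairing). *)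

theory Defs
  imports "HOL-Analysis.Determinants" "HOL-Library.Poly_Mapping"
begin

text \<open>Polynomials in three variables: finitely supported coefficient functions on exponent
  vectors.  The variables $x_1, x_2, x_3$ are indexed by the three elements \<open>1, 2, 3\<close> of
  the numeral type \<open>3\<close> (in which \<open>3 = 0\<close>).\<close>

type_synonym 'a poly3 = "(3 \<Rightarrow>\<^sub>0 nat) \<Rightarrow>\<^sub>0 'a"

definition Const :: "'a::zero \<Rightarrow> 'a poly3"
  where "Const c = Poly_Mapping.single 0 c"

definition Var :: "3 \<Rightarrow> 'a::zero_neq_one poly3"
  where "Var i = Poly_Mapping.single (Poly_Mapping.single i 1) 1"

text \<open>Where \<open>x\<^sub>i\<close> does not occur in a monomial, the truncated subtraction
  of exponents is harmless, since the coefficient vanishes.\<close>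

definition pdiff :: "3 \<Rightarrow> 'a::comm_semiring_1 poly3 \<Rightarrow> 'a poly3"
  where "pdiff i f = (\<Sum>m\<in>Poly_Mapping.keys f.
    Poly_Mapping.single (m - Poly_Mapping.single i 1)
      (of_nat (Poly_Mapping.lookup m i) * Poly_Mapping.lookup f m))"

lemma lookup_pdiff:
  "Poly_Mapping.lookup (pdiff i f) m =
    of_nat (Poly_Mapping.lookup m i + 1) * Poly_Mapping.lookup f (m + Poly_Mapping.single i 1)"
proof -
  have *: "k - Poly_Mapping.single i 1 = m \<and> Poly_Mapping.lookup k i \<noteq> 0 \<longleftrightarrow> k = m + Poly_Mapping.single i 1" for k
    by (auto simp: poly_mapping_eq_iff fun_eq_iff lookup_add lookup_minus lookup_single when_def)
  have "Poly_Mapping.lookup (pdiff i f) m = (\<Sum>k\<in>Poly_Mapping.keys f.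
      if k = m + Poly_Mapping.single i 1 then of_nat (Poly_Mapping.lookup m i + 1) * Poly_Mapping.lookup f k else 0)"
    unfolding pdiff_def lookup_sum
  proof (rule sum.cong[OF refl])
    fix k
    show "Poly_Mapping.lookup (Poly_Mapping.single (k - Poly_Mapping.single i 1) (of_nat (Poly_Mapping.lookup k i) * Poly_Mapping.lookup f k)) m = (if k = m + Poly_Mapping.single i 1 then of_nat (Poly_Mapping.lookup m i + 1) * Poly_Mapping.lookup f k else 0)"
      using *[of k] by (cases "Poly_Mapping.lookup k i = 0") (auto simp: lookup_single when_def lookup_add)
  qed
  also have "\<dots> = of_nat (Poly_Mapping.lookup m i + 1) * Poly_Mapping.lookup f (m + Poly_Mapping.single i 1)"
    by (simp add: in_keys_iff)
  finally show ?thesis .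
qed

definition grad :: "'a::comm_semiring_1 poly3 \<Rightarrow> 'a poly3 ^ 3"
  where "grad f = (\<chi> i. pdiff i f)"

definition Hess :: "'a::comm_semiring_1 poly3 \<Rightarrow> 'a poly3 ^ 3 ^ 3"
  where "Hess f = (\<chi> i j. pdiff i (pdiff j f))"

text \<open>The \<open>(i, j)\<close> entry is the \<open>(j, i)\<close> cofactor of \<open>M\<close>, written as the determinant of
  \<open>M\<close> with row \<open>j\<close> replaced by the \<open>i\<close>-th unit vector.\<close>

definition adjugate :: "'a::comm_ring_1 ^ 'n ^ 'n \<Rightarrow> 'a ^ 'n ^ 'n"
  where "adjugate M = (\<chi> i j. det (\<chi> k. if k = j then axis i 1 else row k M))"

lemma adjugate_mult_3:
  fixes M :: "'a::comm_ring_1 ^ 3 ^ 3"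
  shows "M ** adjugate M = mat (det M)"
  by (simp add: vec_eq_iff forall_3 matrix_matrix_mult_def mat_def sum_3 adjugate_def det_3
      row_def axis_def algebra_simps)

definition bilin_dot :: "'a::comm_semiring_1 ^ 'n \<Rightarrow> 'a ^ 'n \<Rightarrow> 'a"
  where "bilin_dot v w = (\<Sum>i\<in>UNIV. v $ i * w $ i)"

definition U :: "'a::comm_ring_1 poly3 \<Rightarrow> 'a poly3"
  where "U f = bilin_dot (grad f) (adjugate (Hess f) *v grad f)"

definition dir_deriv :: "'a::comm_semiring_1 ^ 3 \<Rightarrow> 'a poly3 \<Rightarrow> 'a poly3"
  where "dir_deriv w f = bilin_dot (\<chi> i. Const (w $ i)) (grad f)"

definition subst :: "(3 \<Rightarrow> 'a::comm_semiring_1 poly3) \<Rightarrow> 'a poly3 \<Rightarrow> 'a poly3"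
  where "subst \<sigma> f = (\<Sum>m\<in>Poly_Mapping.keys f.
    Const (Poly_Mapping.lookup f m) * (\<Prod>i\<in>UNIV. \<sigma> i ^ Poly_Mapping.lookup m i))"

text \<open>The polynomial \<open>f(Ax)\<close>.\<close>

definition lin_subst :: "'a::comm_semiring_1 ^ 3 ^ 3 \<Rightarrow> 'a poly3 \<Rightarrow> 'a poly3"
  where "lin_subst A f = subst (\<lambda>i. \<Sum>j\<in>UNIV. Const (A $ i $ j) * Var j) f"

definition polys_in :: "3 set \<Rightarrow> 'a::zero poly3 set"
  where "polys_in V = {f. \<forall>m\<in>Poly_Mapping.keys f. Poly_Mapping.keys m \<subseteq> V}"

end

theory Submission
  imports Defs "HOL-Computational_Algebra.Polynomial_Factorial"
begin

text \<open>If \<open>U f = 0\<close> then the level surfaces of \<open>f\<close> are ruled by lines along which the direction of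
  \<open>\<nabla>f\<close> is constant.  Working in the field of rational functions, let \<open>\<partial>\<^sub>3 f \<noteq> 0\<close>,
  \<open>p = \<partial>\<^sub>1 f / \<partial>\<^sub>3 f\<close>, \<open>q = \<partial>\<^sub>2 f / \<partial>\<^sub>3 f\<close>.  The derivations \<open>X = \<partial>\<^sub>1 - p \<partial>\<^sub>3\<close> and
  \<open>Y = \<partial>\<^sub>2 - q \<partial>\<^sub>3\<close> annihilate \<open>f\<close> and commute, \<open>X q = Y p\<close>, and \<open>U f\<close> is a multiple of
  \<open>X p * Y q - (Y p)^2\<close>.  If it vanishes, some \<open>E = X + b Y\<close> (or the same with the roles of \<open>X\<close> and \<open>Y\<close>
  exchanged) annihilates \<open>p\<close>, \<open>q\<close> and \<open>b\<close>, hence its own coefficients, and so it is locally nilpotent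
  on polynomials.  A locally nilpotent \<open>E\<close> cannot satisfy \<open>E F = l F\<close>, \<open>E l = l\<^sup>2\<close>
  with \<open>F \<noteq> 0\<close> and \<open>l \<noteq> 0\<close>, because then \<open>E\<^sup>n F = n! l\<^sup>n F\<close>.  With \<open>F = \<partial>\<^sub>3 f\<close> this
  gives \<open>\<partial>\<^sub>i p = - b \<partial>\<^sub>i q\<close> for all \<open>i\<close>, and with \<open>F = \<partial>\<^sub>3 f * Y q\<close> it gives \<open>Y b = 0\<close>.
  Together these make \<open>b\<close> and \<open>p + b q\<close> constant, a linear relation with constant coefficients
  between the partial derivatives of \<open>f\<close>.\<close>

section \<open>Derivations\<close>

locale derivation =
  fixes d :: "'a::field_char_0 \<Rightarrow> 'a"
  assumes add: "d (x + y) = d x + d y"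
    and mult: "d (x * y) = d x * y + x * d y"
begin

lemma zero [simp]: "d 0 = 0"
  using add[of 0 0] by simp

lemma one [simp]: "d 1 = 0"
  using mult[of 1 1] by simp

lemma uminus: "d (- x) = - d x"
  using add[of x "- x"] by (simp add: add_eq_0_iff)

lemma diff: "d (x - y) = d x - d y"
  using add[of x "- y"] by (simp add: uminus)

lemma of_nat [simp]: "d (of_nat n) = 0"
  by (induction n) (simp_all add: add)

lemma divide:
  assumes "y \<noteq> 0"
  shows "d (x / y) = (d x * y - x * d y) / (y * y)"
proof -
  have "d x = d (x / y) * y + x / y * d y"
    using mult[of "x / y" y] assms by simp
  then show ?thesis
    using assms by (simp add: field_simps)
qed

lemma power_of_square:
  assumes "d l = l * l"
  shows "d (l ^ n) = of_nat n * l ^ Suc n"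
  by (induction n) (simp_all add: mult assms algebra_simps)

lemma funpow_zero [simp]: "(d ^^ n) 0 = 0"
  by (induction n) simp_all

lemma funpow_add_distrib: "(d ^^ n) (x + y) = (d ^^ n) x + (d ^^ n) y"
  by (induction n) (simp_all add: add)

lemma funpow_mult_constant:
  assumes "d c = 0"
  shows "(d ^^ n) (c * x) = c * (d ^^ n) x"
  by (induction n) (simp_all add: mult assms)

lemma funpow_eigen:
  assumes "d F = l * F" "d l = l * l"
  shows "(d ^^ n) F = of_nat (fact n) * l ^ n * F"
proof (induction n)
  case (Suc n)
  have "(d ^^ Suc n) F = d (of_nat (fact n) * l ^ n * F)"
    using Suc by simp
  also have "\<dots> = of_nat (fact n) * (of_nat n * l ^ Suc n * F + l ^ n * (l * F))"
    by (simp only: mult of_nat power_of_square[OF assms(2)] assms(1)) (simp add: algebra_simps)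
  also have "\<dots> = of_nat (fact (Suc n)) * l ^ Suc n * F"
    by (simp add: algebra_simps)
  finally show ?case .
qed simp

text \<open>Along the flow of \<open>d\<close> such an \<open>F\<close> behaves like \<open>1 / (1 - s l)\<close>, which is polynomial
  in \<open>s\<close> only if \<open>l = 0\<close>.\<close>

lemma eigenvalue_eq_0:
  assumes "d F = l * F" "d l = l * l" "F \<noteq> 0" "(d ^^ n) F = 0"
  shows "l = 0"
  using funpow_eigen[OF assms(1,2), of n] assms(3,4) by simp

end

text \<open>Stated for a set of derivations, so that their order is immaterial and
  \<open>range pdiff_fract\<close> fits.\<close>

definition constants :: "('a::zero \<Rightarrow> 'a) set \<Rightarrow> 'a set"
  where "constants D = {c. \<forall>d\<in>D. d c = 0}"

text \<open>An abstract bound on the degree, usable inside a field: every \<open>n\<close>-fold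
  composite of members of \<open>D\<close> annihilates \<open>F\<close>, as happens for polynomials
  of degree less than \<open>n\<close> under partial derivatives.\<close>

primrec killed :: "('a::zero \<Rightarrow> 'a) set \<Rightarrow> nat \<Rightarrow> 'a \<Rightarrow> bool" where
  "killed D 0 F \<longleftrightarrow> F = 0"
| "killed D (Suc n) F \<longleftrightarrow> (\<forall>d\<in>D. killed D n (d F))"

locale three_derivations = D1: derivation d1 + D2: derivation d2 + D3: derivation d3
  for d1 d2 d3 :: "'a::field_char_0 \<Rightarrow> 'a" +
  assumes commute: "d1 (d2 x) = d2 (d1 x)" "d1 (d3 x) = d3 (d1 x)" "d2 (d3 x) = d3 (d2 x)"
begin

lemmas expand = D1.add D2.add D3.add D1.mult D2.mult D3.mult D1.diff D2.diff D3.diff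
  D1.uminus D2.uminus D3.uminus D1.divide D2.divide D3.divide commute

text \<open>Since \<open>E\<close> kills its own coefficients, they pull out of every power of
  \<open>E\<close>, and \<open>E ^^ n\<close> becomes a combination of \<open>n\<close>-fold
  composites of the three derivations.\<close>

lemma combination_nilpotent:
  assumes E: "\<And>x. E x = a * d1 x + b * d2 x + c * d3 x"
    and "E a = 0" "E b = 0" "E c = 0" "killed {d1, d2, d3} n F"
  shows "(E ^^ n) F = 0"
proof -
  interpret E: derivation E
    by standard (simp_all add: E expand algebra_simps)
  show ?thesis
    using assms(5)
  proof (induction n arbitrary: F)
    case (Suc n)
    have "(E ^^ Suc n) F = (E ^^ n) (a * d1 F + b * d2 F + c * d3 F)"
      by (simp only: funpow_Suc_right o_apply E)
    also have "\<dots> = 0"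
      using Suc by (simp add: E.funpow_add_distrib E.funpow_mult_constant assms(2-4))
    finally show ?case .
  qed simp
qed

end

section \<open>The Gauss map of a degenerate level surface\<close>

text \<open>The offset in \<open>killed_f\<close> is chosen so that first derivatives of
  \<open>f\<close> are killed in \<open>Suc n\<close> steps and second derivatives in
  \<open>n\<close> steps.\<close>

locale gauss_image = three_derivations d1 d2 d3
  for d1 d2 d3 :: "'a::field_char_0 \<Rightarrow> 'a" +
  fixes f :: 'a and n :: nat
  assumes killed_f: "killed {d1, d2, d3} (Suc (Suc n)) f" and d3f: "d3 f \<noteq> 0"
begin

text \<open>Affine coordinates of the Gauss map, the gradient direction in projective space.\<close>

definition "p = d1 f / d3 f"
definition "q = d2 f / d3 f"
definition "X x = d1 x - p * d3 x"
definition "Y x = d2 x - q * d3 x"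

lemma d1f: "d1 f = p * d3 f" and d2f: "d2 f = q * d3 f"
  using d3f by (simp_all add: p_def q_def)

sublocale X: derivation X
  by standard (simp_all add: X_def expand algebra_simps)

sublocale Y: derivation Y
  by standard (simp_all add: Y_def expand algebra_simps)

lemma X_f: "X f = 0" and Y_f: "Y f = 0"
  by (simp_all add: X_def Y_def d1f d2f)

lemma X_d3: "X (d3 x) = d3 (X x) + d3 p * d3 x" and Y_d3: "Y (d3 x) = d3 (Y x) + d3 q * d3 x"
  by (simp_all add: X_def Y_def expand)

lemma X_Y: "X (Y x) = Y (X x) + (Y p - X q) * d3 x"
  by (simp add: X_def Y_def expand algebra_simps)

text \<open>The commutator of \<open>X\<close> and \<open>Y\<close> is a multiple of
  \<open>d3\<close>; applied to \<open>f\<close>, which both annihilate, it forces this multiple to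
  be zero.\<close>

lemma Xq: "X q = Y p"
  using X_Y[of f] d3f by (simp add: X_f Y_f)

lemma X_Y_commute: "X (Y x) = Y (X x)"
  using X_Y[of x] by (simp add: Xq)

end

text \<open>The vector field \<open>X + b Y\<close> is tangent to the rulings of the level surfaces of \<open>f\<close>.\<close>

locale ruling = gauss_image d1 d2 d3 f n
  for d1 d2 d3 :: "'a::field_char_0 \<Rightarrow> 'a" and f n +
  fixes b :: 'a
  assumes p_ruling: "X p + b * Y p = 0" and q_ruling: "X q + b * Y q = 0"
    and b_ruling: "X b + b * Y b = 0"
begin

definition "E x = X x + b * Y x"

sublocale E: derivation E
  by standard (simp_all add: E_def expand X.add X.mult Y.add Y.mult algebra_simps)

lemma E_zero: "E p = 0" "E q = 0" "E b = 0" "E f = 0"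
  using p_ruling q_ruling b_ruling by (simp_all add: E_def X_f Y_f)

lemma E_nilpotent:
  assumes "killed {d1, d2, d3} m F"
  shows "(E ^^ m) F = 0"
proof (rule combination_nilpotent)
  \<comment> \<open>All three coefficients lie in the kernel of \<open>E\<close>, being built from
    \<open>p\<close>, \<open>q\<close> and \<open>b\<close>.\<close>
  show "E x = 1 * d1 x + b * d2 x + - (p + b * q) * d3 x" for x
    by (simp add: E_def X_def Y_def algebra_simps)
qed (use assms in \<open>simp_all add: E_zero E.add E.mult E.uminus E.diff\<close>)

text \<open>The commutator of \<open>E\<close> and \<open>d3\<close>. On \<open>f\<close>,
  \<open>p\<close> and \<open>q\<close>, where \<open>E\<close> vanishes, it yields the eigenvalue
  equations needed for \<open>d3p\<close>.\<close>

lemma E_d3: "E (d3 x) = d3 (E x) + (d3 p + b * d3 q) * d3 x - d3 b * Y x"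
  by (simp add: E_def X_d3 Y_d3 expand algebra_simps)

lemma E_Y: "E (Y x) = Y (E x) - Y b * Y x"
  by (simp add: E_def X_Y_commute Y.add Y.mult algebra_simps)

lemma d3p: "d3 p + b * d3 q = 0"
proof (rule E.eigenvalue_eq_0)
  let ?l = "d3 p + b * d3 q"
  show "E (d3 f) = ?l * d3 f"
    by (simp add: E_d3 E_zero Y_f)
  \<comment> \<open>The surplus term vanishes because \<open>q_ruling\<close> reads
    \<open>Y p + b * Y q = 0\<close> after replacing \<open>X q\<close> by
    \<open>Y p\<close>.\<close>
  have "E ?l = ?l * ?l - d3 b * (Y p + b * Y q)"
    by (simp add: E.add E.mult E_d3 E_zero algebra_simps)
  then show "E ?l = ?l * ?l"
    using q_ruling by (simp add: Xq)
  show "(E ^^ Suc n) (d3 f) = 0"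
    using E_nilpotent[of "Suc n" "d3 f"] killed_f by simp
qed (rule d3f)

text \<open>By \<open>Xq\<close>, \<open>p_ruling\<close> says \<open>X p + b * X q = 0\<close>, and
  its \<open>d3\<close> part drops out by \<open>d3p\<close>. The same works for \<open>d2\<close>
  with \<open>q_ruling\<close>.\<close>

lemma d1p: "d1 p + b * d1 q = 0"
  using p_ruling d3p unfolding Xq[symmetric] X_def by algebra

lemma d2p: "d2 p + b * d2 q = 0"
  using q_ruling d3p by (simp add: Y_def Xq) algebra

lemma Y_b:
  assumes "Y q \<noteq> 0"
  shows "Y b = 0"
proof -
  have "- Y b = 0"
  proof (rule E.eigenvalue_eq_0)
    have E_d3f: "E (d3 f) = 0"
      by (simp add: E_d3 E_zero Y_f d3p)
    have E_Yq: "E (Y q) = - Y b * Y q"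
      by (simp add: E_Y E_zero)
    then show "E (d3 f * Y q) = - Y b * (d3 f * Y q)"
      by (simp add: E.mult E_d3f)
    show "E (- Y b) = - Y b * - Y b"
      by (simp add: E.uminus E_Y E_zero)
    show "d3 f * Y q \<noteq> 0"
      using assms d3f by simp
    \<comment> \<open>The product is a combination of second derivatives of \<open>f\<close>, with
      coefficients \<open>1\<close>, \<open>r\<close> and \<open>q * q\<close> in the kernel of
      \<open>E\<close>, so \<open>n\<close> applications of \<open>E\<close> annihilate it.\<close>
    define r where "r = - (q + q)"
    have "d3 f * Y q = d2 (d2 f) + r * d3 (d2 f) + q * q * d3 (d3 f)"
      using d3f by (simp add: r_def Y_def q_def expand field_simps)
    moreover have "E r = 0" "E (q * q) = 0"
      by (simp_all only: r_def E.uminus E.add E.mult E_zero) simp_all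
    ultimately show "(E ^^ n) (d3 f * Y q) = 0"
      using killed_f
      by (simp add: E.funpow_add_distrib E.funpow_mult_constant E_nilpotent commute)
  qed
  then show ?thesis by simp
qed

lemma constant_b:
  assumes "Y q \<noteq> 0"
  shows "b \<in> constants {d1, d2, d3}"
proof -
  \<comment> \<open>Mixed second derivatives of \<open>p\<close> agree, so differentiating the
    relations \<open>d1p\<close>, \<open>d2p\<close>, \<open>d3p\<close> crosswise leaves 2 by 2
    minors of the gradients of \<open>b\<close> and \<open>q\<close> equal to zero.\<close>
  have cross: "d2 b * d3 q = d3 b * d2 q" "d1 b * d3 q = d3 b * d1 q"
    using arg_cong[OF d2p, of d3] arg_cong[OF d3p, of d2]
      arg_cong[OF d1p, of d3] arg_cong[OF d3p, of d1]
    by (simp_all add: expand algebra_simps) algebra+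
  have Yb: "d2 b = q * d3 b"
    using Y_b[OF assms] by (simp add: Y_def)
  \<comment> \<open>Substituting \<open>d2 b = q * d3 b\<close> into the first minor turns it into
    \<open>d3 b * (d2 q - q * d3 q)\<close>.\<close>
  then have "d3 b * Y q = 0"
    using cross(1) by (auto simp: Y_def algebra_simps)
  then have b3: "d3 b = 0"
    using assms by simp
  moreover have "X b = 0"
    using b_ruling Y_b[OF assms] by simp
  ultimately show ?thesis
    using Yb by (simp add: constants_def X_def)
qed

lemma constant_p_add:
  assumes "b \<in> constants {d1, d2, d3}"
  shows "p + b * q \<in> constants {d1, d2, d3}"
  using d1p d2p d3p assms by (simp add: constants_def expand)

end

section \<open>Constant linear relations between the partial derivatives\<close>

context gauss_image
begin

lemma dependent_of_ruling:
  assumes "ruling d1 d2 d3 f n b" "b \<in> constants {d1, d2, d3}"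
  shows "\<exists>u\<in>constants {d1, d2, d3}. \<exists>v\<in>constants {d1, d2, d3}.
    d1 f + u * d2 f + v * d3 f = 0"
proof (intro bexI)
  interpret ruling d1 d2 d3 f n b
    by fact
  show "d1 f + b * d2 f + - (p + b * q) * d3 f = 0"
    by (simp add: d1f d2f algebra_simps)
  show "- (p + b * q) \<in> constants {d1, d2, d3}"
    using constant_p_add[OF assms(2)] by (simp add: constants_def D1.uminus D2.uminus D3.uminus del: minus_add_distrib)
qed fact

text \<open>Here \<open>X q\<close> vanishes too, by \<open>Xq\<close>, so \<open>b = 0\<close>
  defines a ruling whatever \<open>Y q\<close> is.\<close>

lemma dependent_if_flat:
  assumes "X p = 0" "Y p = 0"
  shows "\<exists>u\<in>constants {d1, d2, d3}. \<exists>v\<in>constants {d1, d2, d3}.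
    d1 f + u * d2 f + v * d3 f = 0"
proof (rule dependent_of_ruling)
  show "ruling d1 d2 d3 f n 0"
    by standard (simp_all add: assms Xq)
qed (simp add: constants_def)

lemma dependent_if_Yq:
  assumes "X p * Y q = Y p * Y p" and Yq: "Y q \<noteq> 0"
  shows "\<exists>u\<in>constants {d1, d2, d3}. \<exists>v\<in>constants {d1, d2, d3}.
    d1 f + u * d2 f + v * d3 f = 0"
proof -
  \<comment> \<open>The kernel of the degenerate symmetric matrix with rows
    \<open>(X p, Y p)\<close> and \<open>(Y p, Y q)\<close> is spanned by
    \<open>(1, b)\<close>.\<close>
  define b where "b = - (Y p / Y q)"
  have Yp: "Y p = - (b * Y q)"
    using Yq by (simp add: b_def)
  have Xp: "X p = b * b * Y q"
    using assms(1) Yq unfolding Yp by simp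
  \<comment> \<open>Integrability: expanding \<open>X (Y p) = Y (X p)\<close> in terms of
    \<open>b\<close> and \<open>Y q\<close>, the second derivatives of \<open>q\<close> cancel and
    \<open>b_ruling\<close> times \<open>Y q\<close> remains.\<close>
  have "X (Y q) = - (Y b * Y q) - b * Y (Y q)"
    by (simp add: X_Y_commute Xq Yp Y.mult Y.uminus)
  moreover have "X (Y p) = Y (b * b * Y q)"
    by (simp add: X_Y_commute Xp)
  then have "X (- (b * Y q)) = Y (b * b * Y q)"
    unfolding Yp .
  ultimately have "(X b + b * Y b) * Y q = 0"
    unfolding X.uminus X.mult Y.mult by algebra
  then have Xb: "X b + b * Y b = 0"
    using Yq by simp
  have R: "ruling d1 d2 d3 f n b"
    by standard (simp_all add: Xp Yp Xq Xb)
  then interpret ruling d1 d2 d3 f n b .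
  show ?thesis
    using dependent_of_ruling[OF R constant_b[OF Yq]] .
qed

end

text \<open>The negative of the determinant of the bordered Hessian matrix.\<close>

definition bordered_Hessian :: "('a \<Rightarrow> 'a) \<Rightarrow> ('a \<Rightarrow> 'a) \<Rightarrow> ('a \<Rightarrow> 'a) \<Rightarrow> 'a \<Rightarrow> 'a::comm_ring_1"
  where "bordered_Hessian d1 d2 d3 f =
    d1 f * d1 f * (d2 (d2 f) * d3 (d3 f) - d2 (d3 f) * d2 (d3 f)) +
    d2 f * d2 f * (d1 (d1 f) * d3 (d3 f) - d1 (d3 f) * d1 (d3 f)) +
    d3 f * d3 f * (d1 (d1 f) * d2 (d2 f) - d1 (d2 f) * d1 (d2 f)) +
    2 * d1 f * d2 f * (d1 (d3 f) * d2 (d3 f) - d1 (d2 f) * d3 (d3 f)) +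
    2 * d1 f * d3 f * (d1 (d2 f) * d2 (d3 f) - d1 (d3 f) * d2 (d2 f)) +
    2 * d2 f * d3 f * (d1 (d2 f) * d1 (d3 f) - d1 (d1 f) * d2 (d3 f))"

text \<open>On the tangent fields \<open>X\<close> and \<open>Y\<close> the Hessian form of
  \<open>f\<close> has entries \<open>d3 f * X p\<close>, \<open>d3 f * Y p\<close>,
  \<open>d3 f * Y q\<close>; up to the square of \<open>d3 f\<close>, the bordered Hessian is the
  determinant of this restriction.\<close>

lemma (in gauss_image) bordered_Hessian_eq:
  "bordered_Hessian d1 d2 d3 f = (d3 f) ^ 4 * (X p * Y q - Y p * Y p)"
proof -
  have "d3 f * d3 f * d3 f * X p =
      d3 f * d3 f * d1 (d1 f) - 2 * d1 f * d3 f * d1 (d3 f) + d1 f * d1 f * d3 (d3 f)"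
    using d3f by (simp add: X_def p_def expand field_simps)
  moreover have "d3 f * d3 f * d3 f * Y q =
      d3 f * d3 f * d2 (d2 f) - 2 * d2 f * d3 f * d2 (d3 f) + d2 f * d2 f * d3 (d3 f)"
    using d3f by (simp add: Y_def q_def expand field_simps)
  moreover have "d3 f * d3 f * d3 f * Y p =
      d3 f * d3 f * d1 (d2 f) - d2 f * d3 f * d1 (d3 f) -
      d1 f * d3 f * d2 (d3 f) + d1 f * d2 f * d3 (d3 f)"
    using d3f by (simp add: Y_def p_def q_def expand field_simps)
  ultimately have "d3 f * d3 f * bordered_Hessian d1 d2 d3 f =
      d3 f * d3 f * ((d3 f) ^ 4 * (X p * Y q - Y p * Y p))"
    unfolding bordered_Hessian_def by algebra
  then show ?thesis
    using d3f by simp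
qed

lemma (in gauss_image) dependent_gradient:
  assumes "bordered_Hessian d1 d2 d3 f = 0"
  shows "\<exists>t\<in>constants {d1, d2, d3}. \<exists>u\<in>constants {d1, d2, d3}. \<exists>v\<in>constants {d1, d2, d3}.
    (t, u, v) \<noteq> 0 \<and> t * d1 f + u * d2 f + v * d3 f = 0"
proof -
  \<comment> \<open>Exchanging the first two derivations exchanges \<open>X\<close> with
    \<open>Y\<close> and \<open>p\<close> with \<open>q\<close>, so the case
    \<open>X p \<noteq> 0\<close> reduces to the case \<open>Y q \<noteq> 0\<close>.\<close>
  interpret swap: gauss_image d2 d1 d3 f n
    by standard (use killed_f d3f in \<open>simp_all add: commute insert_commute\<close>)
  have swap: "swap.X = Y" "swap.Y = X" "swap.p = q" "swap.q = p"
    "constants {d2, d1, d3} = constants {d1, d2, d3}"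
    by (simp_all add: fun_eq_iff X_def Y_def p_def q_def swap.X_def swap.Y_def swap.p_def
        swap.q_def insert_commute)
  have eq: "X p * Y q = Y p * Y p"
    using assms d3f by (simp add: bordered_Hessian_eq)
  have one: "1 \<in> constants {d1, d2, d3}" 
    by (simp add: constants_def)
  have "Y q = 0 \<Longrightarrow> Y p = 0"
    using eq by simp
  then consider "Y q \<noteq> 0" | "X p \<noteq> 0" | "X p = 0" "Y p = 0"
    by blast
  then show ?thesis
  proof cases
    case 1
    then obtain u v where "u \<in> constants {d1, d2, d3}" "v \<in> constants {d1, d2, d3}"
      "d1 f + u * d2 f + v * d3 f = 0"
      using dependent_if_Yq[OF eq] by blast
    then show ?thesis
      by (intro bexI[of _ 1] bexI[of _ u] bexI[of _ v]) (simp_all add: one zero_prod_def)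
  next
    case 2
    have "\<exists>u\<in>constants {d1, d2, d3}. \<exists>v\<in>constants {d1, d2, d3}. d2 f + u * d1 f + v * d3 f = 0"
      using swap.dependent_if_Yq 2 eq by (simp add: swap Xq mult.commute)
    then obtain u v where "u \<in> constants {d1, d2, d3}" "v \<in> constants {d1, d2, d3}"
      "d2 f + u * d1 f + v * d3 f = 0"
      by blast
    then show ?thesis
      by (intro bexI[of _ u] bexI[of _ 1] bexI[of _ v]) (simp_all add: one zero_prod_def algebra_simps)
  next
    case 3
    then obtain u v where "u \<in> constants {d1, d2, d3}" "v \<in> constants {d1, d2, d3}"
      "d1 f + u * d2 f + v * d3 f = 0"
      using dependent_if_flat by blast
    then show ?thesis
      by (intro bexI[of _ 1] bexI[of _ u] bexI[of _ v]) (simp_all add: one zero_prod_def)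
  qed
qed

section \<open>Polynomials in three variables\<close>

lemma poly_mapping_induct [case_names zero add_single]:
  fixes f :: "'a \<Rightarrow>\<^sub>0 'b::monoid_add"
  assumes "P 0" "\<And>f m c. P f \<Longrightarrow> P (f + Poly_Mapping.single m c)"
  shows "P f"
proof (induction f rule: Poly_Mapping.update_induct)
  case (update f a b)
  have "Poly_Mapping.update a b f = f + Poly_Mapping.single a b"
    using update(1) by (intro poly_mapping_eqI)
      (auto simp: lookup_update lookup_add lookup_single when_def in_keys_iff)
  then show ?case
    using assms(2) update by simp
qed fact

lemma pdiff_add: "pdiff i (f + g) = pdiff i f + pdiff i g"
  by (rule poly_mapping_eqI) (simp add: lookup_pdiff lookup_add algebra_simps)

lemma pdiff_0 [simp]: "pdiff i 0 = 0"
  by (simp add: pdiff_def)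

lemma pdiff_commute: "pdiff i (pdiff j f) = pdiff j (pdiff i f)"
  by (rule poly_mapping_eqI)
    (auto simp: lookup_pdiff lookup_add lookup_single when_def algebra_simps)

lemma pdiff_single:
  "pdiff i (Poly_Mapping.single m c) =
    Poly_Mapping.single (m - Poly_Mapping.single i 1) (of_nat (Poly_Mapping.lookup m i) * c)"
  by (cases "c = 0") (simp_all add: pdiff_def)

lemma pdiff_mult:
  fixes f g :: "'a::comm_semiring_1 poly3"
  shows "pdiff i (f * g) = pdiff i f * g + f * pdiff i g"
proof -
  have single: "pdiff i (Poly_Mapping.single m a * Poly_Mapping.single k b) =
      pdiff i (Poly_Mapping.single m a) * Poly_Mapping.single k b +
      Poly_Mapping.single m a * pdiff i (Poly_Mapping.single k b)" for m k and a b :: 'a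
  proof -
    \<comment> \<open>Truncated subtraction respects addition only when the exponent of variable
      \<open>i\<close> is positive; when it is zero, the coefficient of the derivative
      vanishes.\<close>
    have 1: "m - Poly_Mapping.single i 1 + k = m + k - Poly_Mapping.single i 1"
      if "Poly_Mapping.lookup m i \<noteq> 0" for m k :: "3 \<Rightarrow>\<^sub>0 nat"
      using that by (intro poly_mapping_eqI)
        (auto simp: lookup_add lookup_minus lookup_single when_def)
    have "pdiff i (Poly_Mapping.single m a) * Poly_Mapping.single k b =
      Poly_Mapping.single (m + k - Poly_Mapping.single i 1) (of_nat (Poly_Mapping.lookup m i) * a * b)"
      using 1[of m k] by (cases "Poly_Mapping.lookup m i = 0") (simp_all add: pdiff_single mult_single)
    moreover have "Poly_Mapping.single m a * pdiff i (Poly_Mapping.single k b) =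
      Poly_Mapping.single (m + k - Poly_Mapping.single i 1) (of_nat (Poly_Mapping.lookup k i) * a * b)"
      using 1[of k m] by (cases "Poly_Mapping.lookup k i = 0")
        (simp_all add: pdiff_single mult_single add.commute mult_ac)
    ultimately show ?thesis
      by (simp add: mult_single pdiff_single lookup_add algebra_simps flip: single_add)
  qed
  show ?thesis
  proof (induction f rule: poly_mapping_induct)
    case (add_single f m a)
    have "pdiff i (Poly_Mapping.single m a * g) =
      pdiff i (Poly_Mapping.single m a) * g + Poly_Mapping.single m a * pdiff i g"
      by (induction g rule: poly_mapping_induct) (simp_all add: pdiff_add single algebra_simps)
    with add_single show ?case
      by (simp add: pdiff_add algebra_simps)
  qed simp
qed

lemma pdiff_Const [simp]: "pdiff i (Const c) = 0"
  by (simp add: Const_def pdiff_single)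

lemma pdiff_1 [simp]: "pdiff i 1 = 0"
  using pdiff_Const[of i 1] by (simp add: Const_def)

lemma Const_0 [simp]: "Const 0 = 0" and Const_1 [simp]: "Const 1 = 1"
  and Const_add: "Const (a + b) = Const a + Const b"
  and Const_mult: "Const (c * d) = Const c * Const d"
  by (simp_all add: Const_def single_add mult_single)

lemma Const_sum: "Const (sum h A) = (\<Sum>x\<in>A. Const (h x))"
  by (induction A rule: infinite_finite_induct) (simp_all add: Const_add)

lemma Const_eq_iff [simp]: "Const a = Const b \<longleftrightarrow> a = b"
  by (metis Const_def lookup_single_eq)

text \<open>Each coefficient at a nonzero exponent vector survives in some partial derivative,
  multiplied by a positive integer, which is nonzero in characteristic zero.\<close>

lemma Const_if_pdiff_eq_0:
  fixes f :: "'a::{idom,ring_char_0} poly3"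
  assumes "\<And>i. pdiff i f = 0"
  shows "f \<in> range Const"
proof -
  have "Poly_Mapping.lookup f m = 0" if m: "m \<noteq> 0" for m
  proof -
    obtain i where i: "Poly_Mapping.lookup m i \<noteq> 0"
      using m by (auto simp: poly_mapping_eq_iff fun_eq_iff)
    define k where "k = m - Poly_Mapping.single i 1"
    have k: "m = k + Poly_Mapping.single i 1"
      using i by (intro poly_mapping_eqI) (auto simp: k_def lookup_add lookup_minus lookup_single when_def)
    have "of_nat (Suc (Poly_Mapping.lookup k i)) * Poly_Mapping.lookup f m = 0"
      using lookup_pdiff[of i f k] assms[of i] unfolding k by simp
    then show ?thesis
      by (metis mult_eq_0_iff of_nat_neq_0)
  qed
  then have "f = Const (Poly_Mapping.lookup f 0)"
    by (intro poly_mapping_eqI) (auto simp: Const_def lookup_single when_def)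
  then show ?thesis by blast
qed

text \<open>Shifted by one, so that nonzero constants have degree \<open>1\<close> and only \<open>0\<close> has degree \<open>0\<close>.\<close>

definition total_degree :: "'a::zero poly3 \<Rightarrow> nat"
  where "total_degree f = (if f = 0 then 0
    else Suc (Max ((\<lambda>m. \<Sum>i\<in>UNIV. Poly_Mapping.lookup m i) ` Poly_Mapping.keys f)))"

lemma total_degree_0 [simp]: "total_degree 0 = 0"
  by (simp add: total_degree_def)

lemma total_degree_pdiff_less:
  assumes "f \<noteq> 0"
  shows "total_degree (pdiff i f) < total_degree f"
proof (cases "pdiff i f = 0")
  case False
  let ?w = "\<lambda>m::3 \<Rightarrow>\<^sub>0 nat. \<Sum>i\<in>UNIV. Poly_Mapping.lookup m i"
  have "?w m < Max (?w ` Poly_Mapping.keys f)" if "m \<in> Poly_Mapping.keys (pdiff i f)" for m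
  proof -
    have "Poly_Mapping.lookup f (m + Poly_Mapping.single i 1) \<noteq> 0"
      using that by (auto simp: in_keys_iff lookup_pdiff)
    then have "?w (m + Poly_Mapping.single i 1) \<le> Max (?w ` Poly_Mapping.keys f)"
      by (intro Max_ge) (auto simp: in_keys_iff)
    moreover have "?w (m + Poly_Mapping.single i 1) = Suc (?w m)"
      by (simp add: lookup_add sum.distrib lookup_single when_def)
    ultimately show ?thesis by simp
  qed
  moreover have "Poly_Mapping.keys (pdiff i f) \<noteq> {}"
    using False by (metis keys_eq_empty)
  ultimately have "Max (?w ` Poly_Mapping.keys (pdiff i f)) < Max (?w ` Poly_Mapping.keys f)"
    by (subst Max_less_iff) auto
  then show ?thesis
    using assms False by (simp add: total_degree_def)
qed (use assms in \<open>simp add: total_degree_def\<close>)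

section \<open>Substitution and linear changes of coordinates\<close>

lemma subst_add: "subst \<sigma> (f + g) = subst \<sigma> f + subst \<sigma> g"
  unfolding subst_def
  by (rule setsum_keys_plus_distrib) (simp_all add: Const_add algebra_simps)

lemma subst_single: "subst \<sigma> (Poly_Mapping.single m c) = Const c * (\<Prod>i\<in>UNIV. \<sigma> i ^ Poly_Mapping.lookup m i)"
  by (cases "c = 0") (simp_all add: subst_def)

lemma subst_0 [simp]: "subst \<sigma> 0 = 0"
  by (simp add: subst_def)

lemma subst_Const [simp]: "subst \<sigma> (Const c) = Const c"
  by (simp add: Const_def subst_single)

lemma subst_1 [simp]: "subst \<sigma> 1 = 1"
  using subst_Const[of \<sigma> 1] by simp

lemma subst_Var [simp]: "subst \<sigma> (Var i) = \<sigma> i"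
proof -
  have "(\<Prod>j\<in>UNIV. \<sigma> j ^ Poly_Mapping.lookup (Poly_Mapping.single i 1) j) = (\<Prod>j\<in>UNIV. if i = j then \<sigma> j else 1)"
    by (rule prod.cong) (simp_all add: lookup_single when_def)
  then show ?thesis
    by (simp add: Var_def subst_single)
qed

lemma subst_mult: "subst \<sigma> (f * g) = subst \<sigma> f * subst \<sigma> g"
proof (induction f rule: poly_mapping_induct)
  case (add_single f m a)
  have "subst \<sigma> (Poly_Mapping.single m a * g) = subst \<sigma> (Poly_Mapping.single m a) * subst \<sigma> g"
    by (induction g rule: poly_mapping_induct)
      (simp_all add: subst_add subst_single mult_single Const_mult lookup_add power_add prod.distrib algebra_simps)
  with add_single show ?case
    by (simp add: subst_add algebra_simps)
qed simp

lemma subst_sum: "subst \<sigma> (sum h A) = (\<Sum>x\<in>A. subst \<sigma> (h x))"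
  by (induction A rule: infinite_finite_induct) (simp_all add: subst_add)

lemma single_eq_Const_mult_Var:
  fixes c :: "'a::comm_semiring_1"
  shows "Poly_Mapping.single m c = Const c * (\<Prod>i\<in>UNIV. Var i ^ Poly_Mapping.lookup m i)"
proof -
  have pow: "Var i ^ n = Poly_Mapping.single (Poly_Mapping.single i n) (1 :: 'a)" for i n
    by (induction n) (simp_all add: Var_def mult_single flip: single_add)
  have "(\<Prod>i\<in>A. Var i ^ Poly_Mapping.lookup m i) =
      Poly_Mapping.single (\<Sum>i\<in>A. Poly_Mapping.single i (Poly_Mapping.lookup m i)) (1 :: 'a)" for A :: "3 set"
    by (induction A rule: infinite_finite_induct) (simp_all add: pow mult_single)
  moreover have "(\<Sum>i\<in>UNIV. Poly_Mapping.single i (Poly_Mapping.lookup m i)) = m"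
    by (rule poly_mapping_eqI) (simp add: lookup_sum lookup_single when_def)
  ultimately show ?thesis
    by (simp add: Const_def mult_single)
qed

lemma poly3_induct [case_names Const Var add mult]:
  fixes f :: "'a::comm_semiring_1 poly3"
  assumes "\<And>c. P (Const c)" "\<And>i. P (Var i)"
    "\<And>f g. P f \<Longrightarrow> P g \<Longrightarrow> P (f + g)" "\<And>f g. P f \<Longrightarrow> P g \<Longrightarrow> P (f * g)"
  shows "P f"
proof (induction f rule: poly_mapping_induct)
  case zero
  show ?case using assms(1)[of 0] by simp
next
  case (add_single f m c)
  have one: "P 1" using assms(1)[of 1] by simp
  have "P (Var i ^ k)" for i k
    by (induction k) (simp_all add: one assms)
  then have "P (\<Prod>i\<in>A. Var i ^ Poly_Mapping.lookup m i)" for A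
    by (induction A rule: infinite_finite_induct) (simp_all add: one assms)
  then show ?case
    using add_single by (auto simp: single_eq_Const_mult_Var intro: assms)
qed

lemma subst_subst: "subst \<tau> (subst \<sigma> f) = subst (\<lambda>i. subst \<tau> (\<sigma> i)) f"
  by (induction f rule: poly3_induct) (simp_all add: subst_add subst_mult)

lemma subst_Var_eq [simp]: "subst Var f = f"
  by (induction f rule: poly3_induct) (simp_all add: subst_add subst_mult)

lemma pdiff_Var: "pdiff i (Var j) = (if i = j then 1 else 0)"
  by (auto simp: Var_def pdiff_single lookup_single)

lemma pdiff_sum: "pdiff i (sum h A) = (\<Sum>x\<in>A. pdiff i (h x))"
  by (induction A rule: infinite_finite_induct) (simp_all add: pdiff_add)

text \<open>The chain rule, checked on constants and variables and propagated through sums and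
  products.\<close>

lemma pdiff_subst: "pdiff j (subst \<sigma> f) = (\<Sum>i\<in>UNIV. subst \<sigma> (pdiff i f) * pdiff j (\<sigma> i))"
  by (induction f rule: poly3_induct)
    (simp_all add: subst_add subst_mult pdiff_add pdiff_mult pdiff_Var if_distrib if_distribR sum.distrib
      sum_distrib_left algebra_simps cong: if_cong)

lemma lin_subst_lin_subst: "lin_subst B (lin_subst A f) = lin_subst (A ** B) f"
proof -
  have "subst (\<lambda>i. \<Sum>j\<in>UNIV. Const (B $ i $ j) * Var j) (\<Sum>k\<in>UNIV. Const (A $ i $ k) * Var k) =
      (\<Sum>j\<in>UNIV. Const ((A ** B) $ i $ j) * Var j)" for i
    by (simp add: subst_sum subst_mult matrix_matrix_mult_def Const_sum Const_mult sum_distrib_left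
      sum_distrib_right mult.assoc) (rule sum.swap)
  then show ?thesis
    by (simp add: lin_subst_def subst_subst)
qed

lemma lin_subst_mat_1 [simp]: "lin_subst (mat 1) f = f"
proof -
  have "(\<Sum>j\<in>UNIV. Const (mat 1 $ i $ j) * Var j) = (Var i :: 'a poly3)" for i
    by (simp add: mat_def if_distrib if_distribR cong: if_cong)
  then show ?thesis
    by (simp add: lin_subst_def)
qed

lemma lin_subst_eq_0_iff:
  assumes "invertible A"
  shows "lin_subst A f = 0 \<longleftrightarrow> f = 0"
proof
  obtain B where "A ** B = mat 1"
    using assms by (auto simp: invertible_def)
  then have "f = lin_subst B (lin_subst A f)"
    by (simp add: lin_subst_lin_subst)
  moreover assume "lin_subst A f = 0"
  ultimately show "f = 0"
    by (simp add: lin_subst_def)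
qed (simp add: lin_subst_def)

text \<open>By the chain rule, moving along a coordinate axis before applying \<open>A\<close> is
  moving along a column of \<open>A\<close> afterwards. This links directional derivatives with
  changes of coordinates.\<close>

lemma pdiff_lin_subst: "pdiff j (lin_subst A f) = lin_subst A (dir_deriv (column j A) f)"
  by (simp add: lin_subst_def pdiff_subst pdiff_sum pdiff_mult pdiff_Var dir_deriv_def bilin_dot_def
    subst_sum subst_mult column_def grad_def if_distrib if_distribR mult.commute cong: if_cong)

lemma polys_in_12_iff:
  fixes f :: "'a::{idom,ring_char_0} poly3"
  shows "f \<in> polys_in {1, 2} \<longleftrightarrow> pdiff 3 f = 0"
proof
  assume f: "f \<in> polys_in {1, 2}"
  show "pdiff 3 f = 0"
  proof (rule poly_mapping_eqI)
    fix m :: "3 \<Rightarrow>\<^sub>0 nat"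
    have "3 \<in> Poly_Mapping.keys (m + Poly_Mapping.single 3 1)"
      by (simp add: in_keys_iff lookup_add)
    moreover have "(3 :: 3) \<notin> {1, 2}"
      by simp
    ultimately have "m + Poly_Mapping.single 3 1 \<notin> Poly_Mapping.keys f"
      using f unfolding polys_in_def by blast
    then show "Poly_Mapping.lookup (pdiff 3 f) m = Poly_Mapping.lookup 0 m"
      by (simp add: lookup_pdiff in_keys_iff)
  qed
next
  assume f: "pdiff 3 f = 0"
  have "i \<noteq> 3" if "m \<in> Poly_Mapping.keys f" "i \<in> Poly_Mapping.keys m" for m i
  proof
    assume "i = 3"
    then have "m = m - Poly_Mapping.single 3 1 + Poly_Mapping.single 3 1"
      using that(2) by (intro poly_mapping_eqI) (auto simp: lookup_add lookup_minus lookup_single when_def in_keys_iff)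
    moreover define k where "k = m - Poly_Mapping.single 3 1"
    ultimately have "of_nat (Suc (Poly_Mapping.lookup k 3)) * Poly_Mapping.lookup f m = 0"
      using lookup_pdiff[of 3 f k] f by simp
    then have "Poly_Mapping.lookup f m = 0"
      by (metis mult_eq_0_iff of_nat_neq_0)
    with that(1) show False by (simp add: in_keys_iff)
  qed
  then show "f \<in> polys_in {1, 2}"
    unfolding polys_in_def using exhaust_3 by blast
qed

lemma ex_invertible_column_3:
  fixes w :: "'a::field ^ 3"
  assumes "w \<noteq> 0"
  shows "\<exists>A :: 'a ^ 3 ^ 3. invertible A \<and> column 3 A = w"
proof -
  consider "w $ 1 \<noteq> 0" | "w $ 2 \<noteq> 0" | "w $ 3 \<noteq> 0"
    using assms by (auto simp: vec_eq_iff forall_3)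
  then have "\<exists>A :: 'a ^ 3 ^ 3. det A \<noteq> 0 \<and> column 3 A = w"
  proof cases
    case 1
    then show ?thesis
      by (intro exI[of _ "vector [vector [0, 0, w $ 1], vector [1, 0, w $ 2], vector [0, 1, w $ 3]]"])
        (simp add: det_3 column_def vec_eq_iff forall_3)
  next
    case 2
    then show ?thesis
      by (intro exI[of _ "vector [vector [1, 0, w $ 1], vector [0, 0, w $ 2], vector [0, 1, w $ 3]]"])
        (simp add: det_3 column_def vec_eq_iff forall_3)
  next
    case 3
    then show ?thesis
      by (intro exI[of _ "vector [vector [1, 0, w $ 1], vector [0, 1, w $ 2], vector [0, 0, w $ 3]]"])
        (simp add: det_3 column_def vec_eq_iff forall_3)
  qed
  then show ?thesis
    by (simp add: invertible_det_nz)
qed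

text \<open>The direction \<open>w\<close> corresponds to the third column of \<open>A\<close>: a
  nonzero vector extends to a basis, and an invertible matrix has no zero column.\<close>

lemma dir_deriv_iff_polys_in:
  fixes f :: "'a::field_char_0 poly3"
  shows "(\<exists>w. w \<noteq> 0 \<and> dir_deriv w f = 0) \<longleftrightarrow>
    (\<exists>A. invertible A \<and> lin_subst A f \<in> polys_in {1, 2})"
proof safe
  fix w :: "'a ^ 3"
  assume w: "w \<noteq> 0" "dir_deriv w f = 0"
  obtain A :: "'a ^ 3 ^ 3" where "invertible A" "column 3 A = w"
    using ex_invertible_column_3[OF w(1)] by blast
  with w(2) show "\<exists>A. invertible A \<and> lin_subst A f \<in> polys_in {1, 2}"
    by (auto simp: polys_in_12_iff pdiff_lin_subst lin_subst_eq_0_iff)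
next
  fix A :: "'a ^ 3 ^ 3"
  assume A: "invertible A" "lin_subst A f \<in> polys_in {1, 2}"
  have "column 3 A \<noteq> 0"
    using A(1) det_zero_column[of 3 A] by (auto simp: invertible_det_nz)
  with A show "\<exists>w. w \<noteq> 0 \<and> dir_deriv w f = 0"
    by (auto simp: polys_in_12_iff pdiff_lin_subst lin_subst_eq_0_iff)
qed

section \<open>Partial derivatives of rational functions\<close>

instance fract :: ("{idom,ring_char_0}") ring_char_0
  by standard (auto simp: inj_def of_nat_fract eq_fract)

instance fract :: ("{idom,ring_char_0}") field_char_0 ..

text \<open>The quotient rule, as a definite description because it refers to an arbitrary
  representative; \<open>pdiff_fract_Fract\<close> shows independence of the choice.\<close>

definition pdiff_fract :: "3 \<Rightarrow> 'a::idom poly3 fract \<Rightarrow> 'a poly3 fract"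
  where "pdiff_fract i x = (THE y. \<exists>a b. b \<noteq> 0 \<and> x = Fract a b \<and>
    y = Fract (pdiff i a * b - a * pdiff i b) (b * b))"

lemma pdiff_fract_Fract:
  fixes a b :: "'a::idom poly3"
  assumes "b \<noteq> 0"
  shows "pdiff_fract i (Fract a b) = Fract (pdiff i a * b - a * pdiff i b) (b * b)"
  unfolding pdiff_fract_def
proof (rule the_equality, use assms in blast, clarify)
  fix c e :: "'a poly3"
  assume e: "e \<noteq> 0" and "Fract a b = Fract c e"
  then have eq: "a * e = c * b"
    using assms by (simp add: eq_fract)
  \<comment> \<open>Differentiating the equality of cross products gives the relation between the
    two numerators.\<close>
  have "pdiff i a * e + a * pdiff i e = pdiff i c * b + c * pdiff i b"
    using arg_cong[OF eq, of "pdiff i"] by (simp add: pdiff_mult)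
  with eq have "(pdiff i c * e - c * pdiff i e) * (b * b) = (pdiff i a * b - a * pdiff i b) * (e * e)"
    by algebra
  then show "Fract (pdiff i c * e - c * pdiff i e) (e * e) = Fract (pdiff i a * b - a * pdiff i b) (b * b)"
    using assms e by (simp add: eq_fract)
qed

lemma pdiff_fract_to_fract [simp]: "pdiff_fract i (to_fract f) = to_fract (pdiff i f)"
  by (simp add: to_fract_def pdiff_fract_Fract)

lemma derivation_pdiff_fract:
  "derivation (pdiff_fract i :: 'a::{idom,ring_char_0} poly3 fract \<Rightarrow> _)"
proof
  fix x y :: "'a poly3 fract"
  show "pdiff_fract i (x + y) = pdiff_fract i x + pdiff_fract i y"
    by (cases x; cases y) (simp add: pdiff_fract_Fract eq_fract pdiff_add pdiff_mult algebra_simps)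
  show "pdiff_fract i (x * y) = pdiff_fract i x * y + x * pdiff_fract i y"
    by (cases x; cases y) (simp add: pdiff_fract_Fract eq_fract pdiff_add pdiff_mult algebra_simps)
qed

lemma pdiff_diff: "pdiff i (f - g) = pdiff i f - pdiff i (g :: 'a::comm_ring_1 poly3)"
  by (rule poly_mapping_eqI) (simp add: lookup_pdiff lookup_minus algebra_simps)

lemma pdiff_fract_commute: "pdiff_fract i (pdiff_fract j x) = pdiff_fract j (pdiff_fract i x)"
  by (cases x) (simp add: pdiff_fract_Fract eq_fract pdiff_diff pdiff_mult pdiff_commute[of i j] algebra_simps)

lemma three_derivations_pdiff_fract:
  "three_derivations (pdiff_fract a :: 'a::{idom,ring_char_0} poly3 fract \<Rightarrow> _) (pdiff_fract b) (pdiff_fract c)"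
  by (intro three_derivations.intro three_derivations_axioms.intro derivation_pdiff_fract pdiff_fract_commute)

text \<open>If \<open>x = a / b\<close> is constant, then \<open>x * pdiff i b = pdiff i a\<close>,
  so a nonzero derivative of \<open>b\<close> can serve as a denominator of smaller degree. The
  descent ends with constant numerator and denominator; no reduced fractions are needed.\<close>

lemma constants_pdiff_fract:
  fixes x :: "'a::field_char_0 poly3 fract"
  assumes "x \<in> constants (range pdiff_fract)"
  obtains c where "x = to_fract (Const c)"
proof -
  have const: "pdiff_fract i x = 0" for i
    using assms by (simp add: constants_def)
  have "\<exists>c. x = to_fract (Const c)" if "x * to_fract b = to_fract a" "b \<noteq> 0" for a b
    using that
  proof (induction "total_degree b" arbitrary: a b rule: less_induct)
    case less
    have D: "x * to_fract (pdiff i b) = to_fract (pdiff i a)" for i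
      using arg_cong[OF less(2), of "pdiff_fract i"]
      by (simp add: derivation.mult[OF derivation_pdiff_fract] const)
    show ?case
    proof (cases "\<forall>i. pdiff i b = 0")
      case True
      with D have "pdiff i a = 0" for i
        by (metis mult_zero_right to_fract_0 to_fract_eq_0_iff)
      then obtain c where a: "a = Const c"
        using Const_if_pdiff_eq_0[of a] by auto
      obtain e where b: "b = Const e"
        using Const_if_pdiff_eq_0[of b] True by auto
      have "e \<noteq> 0"
        using less(3) b by auto
      then have "x * to_fract b = to_fract (Const (c / e)) * to_fract b"
        using less(2) by (simp add: a b flip: to_fract_mult Const_mult)
      then show ?thesis
        using less(3) by auto
    next
      case False
      then obtain i where "pdiff i b \<noteq> 0"
        by blast
      then show ?thesis
        using less(1)[OF total_degree_pdiff_less[OF less(3)] D] by blast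
    qed
  qed
  moreover obtain a b where "x = Fract a b" "b \<noteq> 0"
    by (cases x) auto
  then have "x * to_fract b = to_fract a"
    by (simp add: to_fract_def eq_fract)
  ultimately show thesis
    using that \<open>b \<noteq> 0\<close> by blast
qed

lemma killed_to_fract:
  assumes "total_degree f \<le> n"
  shows "killed (range pdiff_fract) n (to_fract f)"
  using assms
proof (induction n arbitrary: f)
  case 0
  then show ?case
    by (auto simp: total_degree_def split: if_splits)
next
  case (Suc n)
  have "total_degree (pdiff i f) \<le> n" for i
    using Suc.prems total_degree_pdiff_less[of f i] by (cases "f = 0") simp_all
  then show ?case
    using Suc.IH by auto
qed

section \<open>Vanishing of the bordered Hessian\<close>

lemma bilin_dot_adjugate_3:
  fixes M :: "'a::comm_ring_1 ^ 3 ^ 3"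
  shows "bilin_dot v (adjugate M *v v) =
    v$1 * v$1 * (M$2$2 * M$3$3 - M$2$3 * M$3$2) +
    v$2 * v$2 * (M$1$1 * M$3$3 - M$1$3 * M$3$1) +
    v$3 * v$3 * (M$1$1 * M$2$2 - M$1$2 * M$2$1) +
    v$1 * v$2 * (M$1$3 * M$3$2 - M$1$2 * M$3$3 + M$3$1 * M$2$3 - M$2$1 * M$3$3) +
    v$1 * v$3 * (M$1$2 * M$2$3 - M$1$3 * M$2$2 + M$2$1 * M$3$2 - M$3$1 * M$2$2) +
    v$2 * v$3 * (M$2$1 * M$1$3 - M$1$1 * M$2$3 + M$1$2 * M$3$1 - M$1$1 * M$3$2)"
  by (simp add: bilin_dot_def adjugate_def matrix_vector_mult_def det_3 sum_3 axis_def row_def algebra_simps)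

lemma U_eq: "U f = bordered_Hessian (pdiff 1) (pdiff 2) (pdiff 3) f"
  by (simp add: U_def bordered_Hessian_def bilin_dot_adjugate_3 grad_def
      Hess_def pdiff_commute[of 2 1 f] pdiff_commute[of 3 1 f] pdiff_commute[of 3 2 f])
    (simp add: algebra_simps)

lemma to_fract_bordered_Hessian:
  fixes f :: "'a::idom poly3"
  shows "bordered_Hessian (pdiff_fract a) (pdiff_fract b) (pdiff_fract c) (to_fract f) =
    to_fract (bordered_Hessian (pdiff a) (pdiff b) (pdiff c) f)"
proof -
  have "to_fract 2 = (2 :: 'a poly3 fract)"
    using to_fract_add[of 1 "1 :: 'a poly3"] by simp
  then show ?thesis
    by (simp add: bordered_Hessian_def)
qed

text \<open>Cyclic symmetry lets any nonvanishing partial derivative take the third place, where it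
  serves as a denominator.\<close>

lemma bordered_Hessian_pdiff_permute:
  "bordered_Hessian (pdiff b) (pdiff c) (pdiff a) f = bordered_Hessian (pdiff a) (pdiff b) (pdiff c) f"
  by (simp add: bordered_Hessian_def pdiff_commute[of c a] pdiff_commute[of b a] pdiff_commute[of c b] algebra_simps)

lemma dependent_pdiff:
  fixes f :: "'a::field_char_0 poly3"
  assumes U: "bordered_Hessian (pdiff a) (pdiff b) (pdiff c) f = 0" and "pdiff c f \<noteq> 0"
    and UNIV: "UNIV = {a, b, c}"
  obtains w :: "'a ^ 3" where "w \<noteq> 0" "dir_deriv w f = 0"
proof -
  have D: "{pdiff_fract a, pdiff_fract b, pdiff_fract c} = range pdiff_fract"
    by (simp add: UNIV)
  \<comment> \<open>The shifted degree already bounds the number of derivatives that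
    \<open>f\<close> survives, so the two extra ones demanded by the locale are slack.\<close>
  interpret gauss_image "pdiff_fract a" "pdiff_fract b" "pdiff_fract c" "to_fract f" "total_degree f"
    by (intro gauss_image.intro gauss_image_axioms.intro three_derivations_pdiff_fract)
      (use assms(2) killed_to_fract[of f "Suc (Suc (total_degree f))"] in
        \<open>simp_all add: D del: killed.simps\<close>)
  obtain t u v where tuv: "t \<in> constants (range pdiff_fract)" "u \<in> constants (range pdiff_fract)"
    "v \<in> constants (range pdiff_fract)" "(t, u, v) \<noteq> 0"
    and dep: "t * to_fract (pdiff a f) + u * to_fract (pdiff b f) + v * to_fract (pdiff c f) = 0"
    using dependent_gradient U unfolding D to_fract_bordered_Hessian by auto
  obtain t' u' v' where const: "t = to_fract (Const t')" "u = to_fract (Const u')" "v = to_fract (Const v')"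
    using tuv(1-3) by (metis constants_pdiff_fract)
  \<comment> \<open>Three indices that exhaust a three-element type are distinct.\<close>
  have "card {a, b, c} = 3"
    unfolding UNIV[symmetric] by simp
  then have ne: "a \<noteq> b" "a \<noteq> c" "b \<noteq> c"
    by (auto simp: card_insert_if split: if_splits)
  define w where "w = (\<chi> i. if i = a then t' else if i = b then u' else v')"
  have w: "w $ a = t'" "w $ b = u'" "w $ c = v'"
    using ne by (simp_all add: w_def)
  have "w \<noteq> 0"
    using tuv(4) w by (auto simp: const zero_prod_def)
  moreover have "to_fract (dir_deriv w f) = 0"
    using dep ne by (simp add: dir_deriv_def bilin_dot_def UNIV w grad_def const algebra_simps)
  ultimately show thesis
    using that by simp
qed

text \<open>With \<open>w\<close> in the kernel of the symmetric matrix \<open>H\<close>, the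
  adjugate of \<open>H\<close> is proportional to the outer product of \<open>w\<close> with itself,
  so its quadratic form at \<open>n\<close> is a multiple of the square of the pairing of
  \<open>w\<close> and \<open>n\<close>, which is zero. The equations \<open>a\<close> state the
  proportionality without division.\<close>

lemma adjugate_form_eq_0:
  fixes h11 h22 h33 h12 h13 h23 n1 n2 n3 w1 w2 w3 :: "'a::idom"
  assumes "w1 * n1 + w2 * n2 + w3 * n3 = 0" "w1 * h11 + w2 * h12 + w3 * h13 = 0"
    "w1 * h12 + w2 * h22 + w3 * h23 = 0" "w1 * h13 + w2 * h23 + w3 * h33 = 0" "w3 \<noteq> 0"
  defines "a11 \<equiv> h22 * h33 - h23 * h23" and "a22 \<equiv> h11 * h33 - h13 * h13"
    and "a33 \<equiv> h11 * h22 - h12 * h12" and "a12 \<equiv> h13 * h23 - h12 * h33"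
    and "a13 \<equiv> h12 * h23 - h13 * h22" and "a23 \<equiv> h12 * h13 - h11 * h23"
  shows "n1 * n1 * a11 + n2 * n2 * a22 + n3 * n3 * a33 +
    2 * n1 * n2 * a12 + 2 * n1 * n3 * a13 + 2 * n2 * n3 * a23 = 0" (is "?U = 0")
proof -
  have a: "w3 * a11 = w1 * a13" "w3 * a12 = w2 * a13" "w3 * a12 = w1 * a23"
    "w3 * a22 = w2 * a23" "w3 * a13 = w1 * a33" "w3 * a23 = w2 * a33"
    using assms(2-4) unfolding assms(6-11) by algebra+
  have "w3 * ?U = 0"
    using a assms(1) by algebra
  then show ?thesis
    using assms(5) by simp
qed

lemma bordered_Hessian_eq_0:
  fixes f :: "'a::idom poly3"
  assumes dep: "Const x * pdiff a f + Const y * pdiff b f + Const z * pdiff c f = 0" and z: "z \<noteq> 0"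
  shows "bordered_Hessian (pdiff a) (pdiff b) (pdiff c) f = 0"
proof -
  \<comment> \<open>Differentiating the relation with constant coefficients puts
    \<open>(x, y, z)\<close> into the kernel of the Hessian.\<close>
  have D: "Const x * pdiff i (pdiff a f) + Const y * pdiff i (pdiff b f) + Const z * pdiff i (pdiff c f) = 0" for i
    using arg_cong[OF dep, of "pdiff i"] by (simp add: pdiff_add pdiff_mult)
  have "Const z \<noteq> 0"
    using z by (metis Const_0 Const_eq_iff)
  then show ?thesis
    unfolding bordered_Hessian_def
    using D[of a] D[of b] D[of c]
    by (intro adjugate_form_eq_0[OF dep]) (simp_all add: pdiff_commute)
qed

lemma U_eq_0_iff:
  fixes f :: "'a::field_char_0 poly3"
  assumes "f \<notin> range Const"
  shows "U f = 0 \<longleftrightarrow> (\<exists>w. w \<noteq> 0 \<and> dir_deriv w f = 0)"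
proof
  assume "U f = 0"
  then have U: "bordered_Hessian (pdiff 1) (pdiff 2) (pdiff 3) f = 0"
      "bordered_Hessian (pdiff 2) (pdiff 3) (pdiff 1) f = 0"
      "bordered_Hessian (pdiff 3) (pdiff 1) (pdiff 2) f = 0"
    by (simp_all add: U_eq bordered_Hessian_pdiff_permute[of 2 3 1] bordered_Hessian_pdiff_permute[of 3 1 2])
  have UNIV: "UNIV = {1, 2, 3 :: 3}" "UNIV = {2, 3, 1 :: 3}" "UNIV = {3, 1, 2 :: 3}"
    using UNIV_3 by blast+
  obtain i where "pdiff i f \<noteq> 0"
    using Const_if_pdiff_eq_0[of f] assms by blast
  then consider "pdiff 1 f \<noteq> 0" | "pdiff 2 f \<noteq> 0" | "pdiff 3 f \<noteq> 0"
    using exhaust_3[of i] by blast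
  then show "\<exists>w. w \<noteq> 0 \<and> dir_deriv w f = 0"
  proof cases
    case 1
    show ?thesis
      by (rule dependent_pdiff[OF U(2) 1 UNIV(2)]) blast
  next
    case 2
    show ?thesis
      by (rule dependent_pdiff[OF U(3) 2 UNIV(3)]) blast
  next
    case 3
    show ?thesis
      by (rule dependent_pdiff[OF U(1) 3 UNIV(1)]) blast
  qed
next
  assume "\<exists>w. w \<noteq> 0 \<and> dir_deriv w f = 0"
  then obtain w where w: "w \<noteq> 0" and "dir_deriv w f = 0"
    by blast
  then have dep: "Const (w $ 1) * pdiff 1 f + Const (w $ 2) * pdiff 2 f + Const (w $ 3) * pdiff 3 f = 0"
    by (simp add: dir_deriv_def bilin_dot_def sum_3 grad_def)
  consider "w $ 1 \<noteq> 0" | "w $ 2 \<noteq> 0" | "w $ 3 \<noteq> 0"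
    using w by (auto simp: vec_eq_iff forall_3)
  then have "bordered_Hessian (pdiff 1) (pdiff 2) (pdiff 3) f = 0"
  proof cases
    case 1
    have "bordered_Hessian (pdiff 2) (pdiff 3) (pdiff 1) f = 0"
      using dep 1 by (intro bordered_Hessian_eq_0[of "w $ 2" 2 f "w $ 3" 3 "w $ 1" 1]) (simp_all add: ac_simps)
    then show ?thesis
      by (simp add: bordered_Hessian_pdiff_permute[of 2 3 1])
  next
    case 2
    have "bordered_Hessian (pdiff 3) (pdiff 1) (pdiff 2) f = 0"
      using dep 2 by (intro bordered_Hessian_eq_0[of "w $ 3" 3 f "w $ 1" 1 "w $ 2" 2]) (simp_all add: ac_simps)
    then show ?thesis
      by (simp add: bordered_Hessian_pdiff_permute[of 3 1 2] bordered_Hessian_pdiff_permute[of 2 3 1])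
  next
    case 3
    with dep show ?thesis
      by (rule bordered_Hessian_eq_0)
  qed
  then show "U f = 0"
    by (simp add: U_eq)
qed

theorem theorem1:
  fixes f :: "complex poly3"
  assumes nonconst: "f \<notin> range Const"
  shows "(U f = 0 \<longleftrightarrow> (\<exists>w::complex ^ 3. w \<noteq> 0 \<and> dir_deriv w f = 0)) \<and>
         ((\<exists>w::complex ^ 3. w \<noteq> 0 \<and> dir_deriv w f = 0) \<longleftrightarrow>
           (\<exists>A::complex ^ 3 ^ 3. invertible A \<and> lin_subst A f \<in> polys_in {1, 2}))"
  using U_eq_0_iff[OF nonconst] dir_deriv_iff_polys_in by blast

end
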